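(* Let $(q_n)_{n \ge 1}$ be a sequence of positive rational numbers, and let $(p_n)_{n \ge 1}$ be a sequence of pairwise distinct prime numbers such that $\gcd(p_i, \mathsf{n}(q_i)) = \gcd(p_i, \mathsf{d}(q_j)) = 1$ for all $i,j \in \mathbb{N}$. Let $M := \big\langle \frac{q_n}{p_n} \mid n \in \mathbb{N} \big\rangle$ be the Puiseux monoid of $(q_n)_{n \ge 1}$ atomized at $(p_n)_{n \ge 1}$. If $\langle q_n \mid n \in \mathbb{N} \rangle$ is an antimatter valuation monoid, then \[ \mathrm{Betti}(M) = \{q_n \mid n \in \mathbb{N}\}. \]
   Context: $\mathbb{N}$ is the set of positive integers. For $q \in \mathbb{Q}_{>0}$, $\mathsf{n}(q)$ and $\mathsf{d}(q)$ are the unique positive integers with $\gcd(\mathsf{n}(q),\mathsf{d}(q))=1$ and $q = \mathsf{n}(q)/\mathsf{d}(q)$. A Puiseux monoid is an additive submonoid of $\mathbb{Q}_{\ge 0}$ (so its only invertible element is $0$). For a set $S$ of nonnegative rationals, $\langle S \rangle$ is the additive submonoid of $\mathbb{Q}_{\ge 0}$ generated by $S$. Under the hypotheses on $(q_n)$ and $(p_n)$ in the statement, the monoid $\langle q_n/p_n \mid n \in \mathbb{N}\rangle$ is called the Puiseux monoid of $(q_n)_{n\ge1}$ atomized at $(p_n)_{n\ge1}$. Let $M$ be a Puiseux monoid. An atom of $M$ is a nonzero element that is not the sum of two nonzero elements of $M$; $\mathcal{A}(M)$ is the set of atoms. $M$ is antimatter if $\mathcal{A}(M)=\emptyset$. For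 $b,c \in M$, $b \mid_M c$ means $c = b+b'$ for some $b' \in M$; $M$ is a valuation monoid if for all $b,c\in M$ either $b \mid_M c$ or $c \mid_M b$. A factorization is an element of the free commutative monoid on $\mathcal{A}(M)$ (a formal sum of atoms), and $\mathsf{Z}(b)$ is the set of factorizations whose sum in $M$ is $b$. The Betti graph $\nabla_b$ of $b \in M$ has vertex set $\mathsf{Z}(b)$ and an edge between distinct $z,z' \in \mathsf{Z}(b)$ exactly when $z$ and $z'$ have at least one atom in common. An element $b\in M$ is a Betti element if $\nabla_b$ is disconnected (has at least two connected components); $\mathrm{Betti}(M)$ is the set of Betti elements of $M$. *)

theory Defs
  imports Complex_Main "HOL-Library.Multiset" "HOL-Computational_Algebra.Primes"
begin

definition rat_num :: "rat \<Rightarrow> int" where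
  "rat_num q = fst (quotient_of q)"

definition rat_den :: "rat \<Rightarrow> int" where
  "rat_den q = snd (quotient_of q)"

definition puiseux_monoid :: "rat set \<Rightarrow> bool" where
  "puiseux_monoid M \<longleftrightarrow>
     M \<subseteq> {0..} \<and> 0 \<in> M \<and> (\<forall>x\<in>M. \<forall>y\<in>M. x + y \<in> M)"

(* The smallest Puiseux monoid containing S. Only meaningful for S \<subseteq> {0..}: otherwise
   no Puiseux monoid contains S and the hull is UNIV. *)
definition generated_monoid :: "rat set \<Rightarrow> rat set" where
  "generated_monoid S = puiseux_monoid hull S"

definition atoms :: "rat set \<Rightarrow> rat set" where
  "atoms M = {a \<in> M. a \<noteq> 0 \<and> \<not> (\<exists>x\<in>M. \<exists>y\<in>M. x \<noteq> 0 \<and> y \<noteq> 0 \<and> a = x + y)}"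

definition antimatter :: "rat set \<Rightarrow> bool" where
  "antimatter M \<longleftrightarrow> atoms M = {}"

definition mdvd :: "rat set \<Rightarrow> rat \<Rightarrow> rat \<Rightarrow> bool" where
  "mdvd M b c \<longleftrightarrow> (\<exists>b'\<in>M. c = b + b')"

definition valuation_monoid :: "rat set \<Rightarrow> bool" where
  "valuation_monoid M \<longleftrightarrow> (\<forall>b\<in>M. \<forall>c\<in>M. mdvd M b c \<or> mdvd M c b)"

(* The free commutative monoid on the atoms is the set of finite multisets of atoms. *)
definition factorizations :: "rat set \<Rightarrow> rat \<Rightarrow> rat multiset set" where
  "factorizations M b = {z. set_mset z \<subseteq> atoms M \<and> sum_mset z = b}"

definition betti_edges :: "rat set \<Rightarrow> rat \<Rightarrow> (rat multiset \<times> rat multiset) set" where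
  "betti_edges M b =
     {(z, z'). z \<in> factorizations M b \<and> z' \<in> factorizations M b \<and> z \<noteq> z' \<and>
               set_mset z \<inter> set_mset z' \<noteq> {}}"

(* Connected components of the Betti graph, as classes of vertices under joinability by a
   path. The reflexive closure relates every multiset to itself, hence the restriction to
   the vertex set. *)
definition betti_components :: "rat set \<Rightarrow> rat \<Rightarrow> rat multiset set set" where
  "betti_components M b =
     factorizations M b //
       ((betti_edges M b)\<^sup>* \<inter> factorizations M b \<times> factorizations M b)"

(* At least two components; phrased without card, as there may be infinitely many. *)
definition Betti :: "rat set \<Rightarrow> rat set" where
  "Betti M = {b \<in> M. \<exists>C \<in> betti_components M b. \<exists>D \<in> betti_components M b. C \<noteq> D}"

end

theory Submission imports Defs begin

text \<open>
  Write \<open>a\<^sub>n = q\<^sub>n / p\<^sub>n\<close>. Since \<open>a\<^sub>n\<close> is the only generator of \<open>M\<close> that is not \<open>p\<^sub>n\<close>-integral,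
  the multiplicities of \<open>a\<^sub>n\<close> in two factorizations of the same element agree modulo \<open>p\<^sub>n\<close>.
  It follows that the atoms of \<open>M\<close> are exactly the \<open>a\<^sub>n\<close>, and that an element \<open>b\<close> whose
  factorizations have no common atom has all its multiplicities divisible by the respective
  \<open>p\<^sub>n\<close>. For such \<open>b\<close>, let \<open>a\<^sub>i\<close> occur in \<open>z\<close> and \<open>a\<^sub>j\<close> in \<open>z'\<close>, where \<open>q\<^sub>j = q\<^sub>i + y\<close> by the
  valuation property. Replacing \<open>p\<^sub>j\<close> copies of \<open>a\<^sub>j\<close> in \<open>z'\<close> by \<open>p\<^sub>i\<close> copies of \<open>a\<^sub>i\<close> and a
  factorization of \<open>y\<close> gives a common neighbour of \<open>z\<close> and \<open>z'\<close>, unless nothing of \<open>z'\<close> is left,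
  that is, \<open>b = q\<^sub>j\<close>. Conversely, \<open>p\<^sub>n\<close> copies of \<open>a\<^sub>n\<close> are an isolated vertex of the Betti graph
  of \<open>q\<^sub>n\<close>, and a second vertex exists because \<open>q\<^sub>n\<close> is not an atom of the monoid of the \<open>q\<^sub>i\<close>.
\<close>

lemma sum_mset_nonneg_rat:
  fixes z :: "rat multiset"
  assumes "set_mset z \<subseteq> {0..}"
  shows "sum_mset z \<ge> 0"
  using assms by (induction z) auto

lemma sum_mset_pos_rat:
  fixes z :: "rat multiset"
  assumes "set_mset z \<subseteq> {0<..}" "z \<noteq> {#}"
  shows "sum_mset z > 0"
  using assms
proof (induction z)
  case (add x z)
  then show ?case by (cases "z = {#}") (auto intro: add_pos_pos)
qed simp

lemma generated_monoid_eq: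
  assumes "S \<subseteq> {0..}"
  shows "generated_monoid S = {sum_mset z | z. set_mset z \<subseteq> S}"
  unfolding generated_monoid_def
proof (rule hull_unique)
  show "S \<subseteq> {sum_mset z | z. set_mset z \<subseteq> S}"
  proof
    fix x assume "x \<in> S"
    then show "x \<in> {sum_mset z | z. set_mset z \<subseteq> S}"
      by (intro CollectI exI[of _ "{#x#}"]) auto
  qed
  show "puiseux_monoid {sum_mset z | z. set_mset z \<subseteq> S}"
    unfolding puiseux_monoid_def
  proof (intro conjI ballI)
    show "{sum_mset z | z. set_mset z \<subseteq> S} \<subseteq> {0..}"
      using assms sum_mset_nonneg_rat by fastforce
    show "0 \<in> {sum_mset z | z. set_mset z \<subseteq> S}"
      by (intro CollectI exI[of _ "{#}"]) auto
  next
    fix x y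
    assume "x \<in> {sum_mset z | z. set_mset z \<subseteq> S}" "y \<in> {sum_mset z | z. set_mset z \<subseteq> S}"
    then obtain z w where "x = sum_mset z" "y = sum_mset w" "set_mset z \<subseteq> S" "set_mset w \<subseteq> S"
      by auto
    then show "x + y \<in> {sum_mset z | z. set_mset z \<subseteq> S}"
      by (intro CollectI exI[of _ "z + w"]) auto
  qed
next
  fix T assume T: "S \<subseteq> T" "puiseux_monoid T"
  have "sum_mset z \<in> T" if "set_mset z \<subseteq> S" for z
    using that T by (induction z) (auto simp: puiseux_monoid_def)
  then show "{sum_mset z | z. set_mset z \<subseteq> S} \<subseteq> T" by auto
qed

lemma Betti_iff:
  "b \<in> Betti M \<longleftrightarrow> b \<in> M \<and>
     (\<exists>z \<in> factorizations M b. \<exists>z' \<in> factorizations M b. (z, z') \<notin> (betti_edges M b)\<^sup>*)"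
proof -
  let ?Z = "factorizations M b"
  let ?r = "(betti_edges M b)\<^sup>* \<inter> ?Z \<times> ?Z"
  have "(\<exists>C \<in> ?Z // ?r. \<exists>D \<in> ?Z // ?r. C \<noteq> D) \<longleftrightarrow>
        (\<exists>z \<in> ?Z. \<exists>z' \<in> ?Z. (z, z') \<notin> (betti_edges M b)\<^sup>*)"
  proof
    assume "\<exists>C \<in> ?Z // ?r. \<exists>D \<in> ?Z // ?r. C \<noteq> D"
    then obtain z z' where z: "z \<in> ?Z" "z' \<in> ?Z" "?r `` {z} \<noteq> ?r `` {z'}"
      by (auto elim!: quotientE)
    show "\<exists>z \<in> ?Z. \<exists>z' \<in> ?Z. (z, z') \<notin> (betti_edges M b)\<^sup>*"
    proof (rule ccontr)
      assume "\<not> ?thesis"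
      then have "?r `` {z} = ?Z" "?r `` {z'} = ?Z" using z(1,2) by blast+
      with z(3) show False by simp
    qed
  next
    assume "\<exists>z \<in> ?Z. \<exists>z' \<in> ?Z. (z, z') \<notin> (betti_edges M b)\<^sup>*"
    then obtain z z' where z: "z \<in> ?Z" "z' \<in> ?Z" "(z, z') \<notin> (betti_edges M b)\<^sup>*" by blast
    then have "?r `` {z} \<noteq> ?r `` {z'}" by blast
    then show "\<exists>C \<in> ?Z // ?r. \<exists>D \<in> ?Z // ?r. C \<noteq> D"
      using z(1,2) by (meson quotientI)
  qed
  then show ?thesis by (simp add: Betti_def betti_components_def)
qed

lemma sym_betti_edges: "sym (betti_edges M b)"
  by (auto simp: sym_def betti_edges_def)

lemma betti_path_if_common_atom:
  assumes "z \<in> factorizations M b" "z' \<in> factorizations M b" "x \<in># z" "x \<in># z'"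
  shows "(z, z') \<in> (betti_edges M b)\<^sup>*"
proof (cases "z = z'")
  case False
  then have "(z, z') \<in> betti_edges M b" using assms by (auto simp: betti_edges_def)
  then show ?thesis ..
qed simp

definition integral_at :: "nat \<Rightarrow> rat \<Rightarrow> bool" where
  "integral_at l x \<longleftrightarrow> (\<exists>u v :: int. \<not> int l dvd v \<and> x = of_int u / of_int v)"

lemma integral_atI: "\<not> int l dvd v \<Longrightarrow> x = of_int u / of_int v \<Longrightarrow> integral_at l x"
  unfolding integral_at_def by blast

lemma integral_at_0: "prime l \<Longrightarrow> integral_at l 0"
  by (rule integral_atI[of _ 1 _ 0]) (auto dest: prime_gt_1_nat)

lemma integral_at_add:
  assumes "prime l" "integral_at l x" "integral_at l y"
  shows "integral_at l (x + y)"
proof -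
  obtain u v where uv: "\<not> int l dvd v" "x = of_int u / of_int v"
    using assms(2) unfolding integral_at_def by blast
  obtain s t where st: "\<not> int l dvd t" "y = of_int s / of_int t"
    using assms(3) unfolding integral_at_def by blast
  have nz: "v \<noteq> 0" "t \<noteq> 0" using uv(1) st(1) by auto
  have "\<not> int l dvd v * t" using uv(1) st(1) assms(1) by (simp add: prime_dvd_mult_iff)
  moreover have "x + y = of_int (u * t + s * v) / of_int (v * t)"
    using nz by (simp add: uv(2) st(2) field_simps)
  ultimately show ?thesis by (rule integral_atI)
qed

lemma integral_at_minus:
  assumes "integral_at l x"
  shows "integral_at l (- x)"
proof -
  obtain u v where "\<not> int l dvd v" "x = of_int u / of_int v"
    using assms unfolding integral_at_def by blast
  then show ?thesis by (intro integral_atI[of l v _ "- u"]) simp_all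
qed

lemma integral_at_diff:
  "prime l \<Longrightarrow> integral_at l x \<Longrightarrow> integral_at l y \<Longrightarrow> integral_at l (x - y)"
  using integral_at_add[of l x "- y"] by (simp add: integral_at_minus)

lemma rat_eq_num_div_den: "x = of_int (rat_num x) / of_int (rat_den x)"
  unfolding rat_num_def rat_den_def by (rule quotient_of_div) simp

lemma rat_den_pos: "rat_den x > 0"
  unfolding rat_den_def by (rule quotient_of_denom_pos')

lemma not_prime_dvd_if_gcd_eq_1:
  assumes "prime l" "gcd (int l) k = 1"
  shows "\<not> int l dvd k"
proof
  assume "int l dvd k"
  then have "int l dvd gcd (int l) k" by simp
  then show False using assms prime_gt_1_nat[of l] by simp
qed

locale atomized =
  fixes q :: "nat \<Rightarrow> rat" and p :: "nat \<Rightarrow> nat"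
  assumes q_pos: "n \<ge> 1 \<Longrightarrow> q n > 0"
    and prime_p: "n \<ge> 1 \<Longrightarrow> prime (p n)"
    and inj_p: "inj_on p {1..}"
    and coprime_num: "i \<ge> 1 \<Longrightarrow> gcd (int (p i)) (rat_num (q i)) = 1"
    and coprime_den: "i \<ge> 1 \<Longrightarrow> j \<ge> 1 \<Longrightarrow> gcd (int (p i)) (rat_den (q j)) = 1"
begin

definition a :: "nat \<Rightarrow> rat" where "a n = q n / of_nat (p n)"

definition A :: "rat set" where "A = a ` {1..}"

abbreviation M :: "rat set" where "M \<equiv> generated_monoid A"

abbreviation N :: "rat set" where "N \<equiv> generated_monoid (q ` {1..})"

lemma p_pos: "n \<ge> 1 \<Longrightarrow> p n > 0"
  using prime_p prime_gt_0_nat by blast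

lemma a_pos: "n \<ge> 1 \<Longrightarrow> a n > 0"
  using q_pos p_pos by (simp add: a_def)

lemma p_mult_a: "n \<ge> 1 \<Longrightarrow> of_nat (p n) * a n = q n"
  using p_pos[of n] by (simp add: a_def)

lemma a_in_A: "n \<ge> 1 \<Longrightarrow> a n \<in> A"
  by (simp add: A_def)

lemma A_pos: "A \<subseteq> {0<..}"
  using a_pos by (auto simp: A_def)

lemma M_eq: "M = {sum_mset z | z. set_mset z \<subseteq> A}"
  using A_pos by (intro generated_monoid_eq) auto

lemma sum_mset_eq_0: "set_mset z \<subseteq> A \<Longrightarrow> sum_mset z = 0 \<Longrightarrow> z = {#}"
  using sum_mset_pos_rat[of z] A_pos by (metis less_irrefl subset_trans)

lemma q_eq_frac: "q n = of_int (rat_num (q n)) / of_int (rat_den (q n))"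
  by (rule rat_eq_num_div_den)

lemma integral_at_a:
  assumes "m \<ge> 1" "n \<ge> 1" "m \<noteq> n"
  shows "integral_at (p n) (a m)"
proof (rule integral_atI)
  have "p m \<noteq> p n" using inj_p assms by (auto dest: inj_onD)
  then have "\<not> p n dvd p m"
    using prime_p assms by (metis primes_dvd_imp_eq)
  then show "\<not> int (p n) dvd rat_den (q m) * int (p m)"
    using not_prime_dvd_if_gcd_eq_1[OF _ coprime_den] prime_p assms
    by (simp add: prime_dvd_mult_iff)
  show "a m = of_int (rat_num (q m)) / of_int (rat_den (q m) * int (p m))"
    by (subst a_def, subst q_eq_frac) simp
qed

lemma dvd_if_integral_at_mult_a:
  assumes "n \<ge> 1" "integral_at (p n) (of_int k * a n)"
  shows "int (p n) dvd k"
proof -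
  let ?s = "rat_num (q n)" and ?t = "rat_den (q n)"
  obtain u v where uv: "\<not> int (p n) dvd v" "of_int k * a n = of_int u / of_int v"
    using assms(2) unfolding integral_at_def by blast
  have "v \<noteq> 0" using uv(1) by auto
  have "of_int k * (of_int ?s / of_int ?t / of_nat (p n)) = of_int u / (of_int v :: rat)"
    using uv(2) unfolding a_def by (subst (asm) q_eq_frac)
  then have "of_int (k * ?s * v) = (of_int (u * ?t * int (p n)) :: rat)"
    using \<open>v \<noteq> 0\<close> rat_den_pos[of "q n"] p_pos[OF assms(1)] by (simp add: field_simps)
  then have "k * ?s * v = u * ?t * int (p n)" by (simp only: of_int_eq_iff)
  then have "int (p n) dvd k * ?s * v" by simp
  moreover have "\<not> int (p n) dvd ?s"
    using not_prime_dvd_if_gcd_eq_1 prime_p coprime_num assms(1) by blast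
  ultimately show ?thesis
    using uv(1) prime_p[OF assms(1)] by (simp add: prime_dvd_mult_iff)
qed

lemma inj_a: "inj_on a {1..}"
proof (rule inj_onI)
  fix m n :: nat assume mn: "m \<in> {1..}" "n \<in> {1..}" "a m = a n"
  show "m = n"
  proof (rule ccontr)
    assume "m \<noteq> n"
    then have "integral_at (p n) (of_int 1 * a n)" using integral_at_a[of m n] mn by simp
    then have "int (p n) dvd 1" using mn(2) by (intro dvd_if_integral_at_mult_a) auto
    then show False using prime_p[of n] mn(2) prime_gt_1_nat[of "p n"] by simp
  qed
qed

lemma integral_at_sum_minus_count:
  assumes "set_mset z \<subseteq> A" "n \<ge> 1"
  shows "integral_at (p n) (sum_mset z - of_nat (count z (a n)) * a n)"
  using assms(1)
proof (induction z)
  case empty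
  then show ?case using integral_at_0 prime_p assms(2) by simp
next
  case (add x z)
  then have IH: "integral_at (p n) (sum_mset z - of_nat (count z (a n)) * a n)" by simp
  obtain m where m: "m \<ge> 1" "x = a m" using add.prems by (auto simp: A_def)
  show ?case
  proof (cases "m = n")
    case True
    then show ?thesis using IH m by (simp add: algebra_simps)
  next
    case False
    then have "a m \<noteq> a n" using inj_a m(1) assms(2) by (auto dest: inj_onD)
    then have "sum_mset (add_mset x z) - of_nat (count (add_mset x z) (a n)) * a n
        = a m + (sum_mset z - of_nat (count z (a n)) * a n)"
      using m by simp
    then show ?thesis
      using integral_at_add[OF prime_p[OF assms(2)] integral_at_a[OF m(1) assms(2) False] IH]
      by (simp only:)
  qed
qed

lemma count_cong:
  assumes "set_mset z \<subseteq> A" "set_mset z' \<subseteq> A" "sum_mset z = sum_mset z'" "n \<ge> 1"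
  shows "int (p n) dvd int (count z (a n)) - int (count z' (a n))"
proof -
  let ?f = "\<lambda>z. sum_mset z - of_nat (count z (a n)) * a n"
  have "?f z' - ?f z = of_int (int (count z (a n)) - int (count z' (a n))) * a n"
    using assms(3) by (simp add: algebra_simps)
  then show ?thesis
    using integral_at_diff[OF prime_p integral_at_sum_minus_count integral_at_sum_minus_count]
      assms dvd_if_integral_at_mult_a by metis
qed

lemma mem_if_sum_eq_a:
  assumes "set_mset z \<subseteq> A" "sum_mset z = a n" "n \<ge> 1"
  shows "a n \<in># z"
proof (rule ccontr)
  assume "a n \<notin># z"
  then have "int (p n) dvd 0 - 1"
    using count_cong[of z "{#a n#}" n] assms by (simp add: A_def not_in_iff)
  then show False using prime_p[of n] assms(3) prime_gt_1_nat[of "p n"] by simp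
qed

lemma atoms_M: "atoms M = A"
proof (intro equalityI subsetI)
  fix x assume x: "x \<in> atoms M"
  then obtain z where z: "set_mset z \<subseteq> A" "x = sum_mset z" "x \<noteq> 0"
    unfolding atoms_def M_eq by blast
  then obtain y w where w: "z = add_mset y w" by (metis multiset_cases sum_mset.empty)
  have "y \<noteq> 0" using z(1) w A_pos by auto
  moreover have "y \<in> M" unfolding M_eq using z(1) w by (intro CollectI exI[of _ "{#y#}"]) auto
  moreover have "sum_mset w \<in> M" unfolding M_eq using z(1) w by auto
  ultimately have "sum_mset w = 0" using x z(2) w unfolding atoms_def by auto
  then show "x \<in> A" using z w by auto
next
  fix x assume "x \<in> A"
  then obtain n where n: "n \<ge> 1" "x = a n" by (auto simp: A_def)
  have "x \<in> M" unfolding M_eq using \<open>x \<in> A\<close> by (intro CollectI exI[of _ "{#x#}"]) auto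
  moreover have False if yz: "y \<in> M" "z \<in> M" "y \<noteq> 0" "z \<noteq> 0" "x = y + z" for y z
  proof -
    obtain u v where uv: "set_mset u \<subseteq> A" "set_mset v \<subseteq> A" "y = sum_mset u" "z = sum_mset v"
      using yz(1,2) unfolding M_eq by blast
    then have "a n \<in># u + v" using mem_if_sum_eq_a[of "u + v" n] yz(5) n by simp
    then obtain w where w: "u + v = add_mset (a n) w" by (meson mset_add)
    then have "set_mset w \<subseteq> A" using uv by (metis set_mset_add_mset_insert set_mset_union Un_subset_iff insert_subset)
    moreover have "sum_mset w = 0"
      using arg_cong[OF w, of sum_mset] uv yz(5) n by simp
    ultimately have "u + v = {#a n#}" using w sum_mset_eq_0 by simp
    then have "u = {#} \<or> v = {#}" by (metis union_is_single)
    then show False using yz uv by auto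
  qed
  moreover have "x \<noteq> 0" using a_pos n by force
  ultimately show "x \<in> atoms M" unfolding atoms_def by blast
qed

lemma factorizations_M: "factorizations M b = {z. set_mset z \<subseteq> A \<and> sum_mset z = b}"
  by (simp add: factorizations_def atoms_M)

definition lift :: "nat multiset \<Rightarrow> rat multiset" where
  "lift K = (\<Sum>n\<in>#K. replicate_mset (p n) (a n))"

lemma lift_simps [simp]:
  "lift {#} = {#}" "lift (add_mset n K) = replicate_mset (p n) (a n) + lift K"
  by (simp_all add: lift_def)

lemma set_lift: "set_mset K \<subseteq> {1..} \<Longrightarrow> set_mset (lift K) = a ` set_mset K"
proof (induction K)
  case (add n K)
  then show ?case using p_pos[of n] by simp
qed simp

lemma set_lift_subset_A: "set_mset K \<subseteq> {1..} \<Longrightarrow> set_mset (lift K) \<subseteq> A"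
  by (auto simp: set_lift A_def)

lemma sum_lift: "set_mset K \<subseteq> {1..} \<Longrightarrow> sum_mset (lift K) = sum_mset (image_mset q K)"
  by (induction K) (auto simp: p_mult_a)

lemma N_eq: "N = {sum_mset (image_mset q K) | K. set_mset K \<subseteq> {1..}}"
proof -
  have "q ` {1..} \<subseteq> {0..}" using q_pos by (auto intro: less_imp_le)
  then have "N = {sum_mset z | z. set_mset z \<subseteq> q ` {1..}}" by (rule generated_monoid_eq)
  also have "\<dots> = {sum_mset (image_mset q K) | K. set_mset K \<subseteq> {1..}}"
  proof -
    have "\<exists>K. set_mset K \<subseteq> {1..} \<and> image_mset q K = z" if "set_mset z \<subseteq> q ` {1..}" for z
      using that
    proof (induction z)
      case (add x z)
      then obtain K m where "set_mset K \<subseteq> {1..}" "image_mset q K = z" "m \<ge> 1" "q m = x"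
        by auto
      then show ?case by (intro exI[of _ "add_mset m K"]) auto
    qed simp
    moreover have "set_mset (image_mset q K) \<subseteq> q ` {1..}" if "set_mset K \<subseteq> {1..}" for K
      using that by auto
    ultimately show ?thesis by blast
  qed
  finally show ?thesis .
qed

lemma q_in_N: "n \<ge> 1 \<Longrightarrow> q n \<in> N"
  unfolding N_eq by (intro CollectI exI[of _ "{#n#}"]) auto

lemma replicate_in_factorizations:
  "n \<ge> 1 \<Longrightarrow> replicate_mset (p n) (a n) \<in> factorizations M (q n)"
  unfolding factorizations_M by (simp add: p_mult_a a_in_A)

lemma q_in_M: "n \<ge> 1 \<Longrightarrow> q n \<in> M"
  using replicate_in_factorizations[of n, unfolded factorizations_M]
  unfolding M_eq mem_Collect_eq by metis

lemma q_factorization_eq_replicate: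
  assumes "z \<in> factorizations M (q n)" "n \<ge> 1" "a n \<in># z"
  shows "z = replicate_mset (p n) (a n)"
proof -
  let ?r = "replicate_mset (p n) (a n)"
  have "int (p n) dvd int (count z (a n)) - int (count ?r (a n))"
    using count_cong[of z ?r n] assms(1,2) replicate_in_factorizations[of n]
    by (simp add: factorizations_M)
  then have "int (p n) dvd int (count z (a n)) - int (p n) + int (p n)"
    by (intro dvd_add) simp_all
  then have "p n dvd count z (a n)" by simp
  then have "p n \<le> count z (a n)"
    using assms(3) by (intro dvd_imp_le) auto
  then have sub: "?r \<subseteq># z" by (simp add: count_le_replicate_mset_subset_eq)
  then have "sum_mset z = sum_mset ?r + sum_mset (z - ?r)"
    by (metis sum_mset.union subset_mset.add_diff_inverse)
  then have "sum_mset (z - ?r) = 0"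
    using assms(1,2) by (simp add: factorizations_M p_mult_a)
  moreover have "set_mset (z - ?r) \<subseteq> A"
    using assms(1) by (auto simp: factorizations_M dest: in_diffD)
  ultimately have "z - ?r = {#}" by (intro sum_mset_eq_0)
  then show ?thesis using sub by (metis subset_mset.add_diff_inverse add.right_neutral)
qed

lemma q_in_Betti:
  assumes "antimatter N" "n \<ge> 1"
  shows "q n \<in> Betti M"
proof -
  let ?r = "replicate_mset (p n) (a n)"
  have "q n \<notin> atoms N" using assms(1) by (simp add: antimatter_def)
  then obtain x y where xy: "x \<in> N" "y \<in> N" "x \<noteq> 0" "y \<noteq> 0" "q n = x + y"
    using q_in_N[OF assms(2)] q_pos[OF assms(2)] unfolding atoms_def by force
  obtain K L where KL: "set_mset K \<subseteq> {1..}" "set_mset L \<subseteq> {1..}"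
    "x = sum_mset (image_mset q K)" "y = sum_mset (image_mset q L)"
    using xy(1,2) unfolding N_eq by blast
  let ?z = "lift K + lift L"
  have z: "?z \<in> factorizations M (q n)"
    unfolding factorizations_M using KL xy(5) by (simp add: set_lift_subset_A sum_lift)
  have "?z \<noteq> ?r"
  proof
    assume r: "?z = ?r"
    have ne: "K \<noteq> {#}" "L \<noteq> {#}" using KL xy(3,4) by auto
    have mem: "n \<in># J" if J: "J \<noteq> {#}" "set_mset J \<subseteq> {1..}" "set_mset (lift J) \<subseteq> {a n}" for J
    proof -
      obtain m where "m \<in># J" using J(1) by blast
      then have "a m = a n" "m \<ge> 1" using J set_lift[OF J(2)] by auto
      then show ?thesis using inj_a assms(2) \<open>m \<in># J\<close> by (auto dest: inj_onD)
    qed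
    have "set_mset (lift K) \<union> set_mset (lift L) \<subseteq> {a n}"
      using arg_cong[OF r, of set_mset] by auto
    then have "n \<in># K" "n \<in># L" using mem ne KL by auto
    then have "p n \<le> count (lift K) (a n)" "p n \<le> count (lift L) (a n)"
      by (auto dest!: multi_member_split)
    moreover have "count ?z (a n) = p n" by (simp add: r)
    ultimately show False using p_pos[OF assms(2)] by simp
  qed
  moreover have "(?r, w) \<notin> betti_edges M (q n)" for w
  proof
    assume "(?r, w) \<in> betti_edges M (q n)"
    then have "w \<in> factorizations M (q n)" "?r \<noteq> w" "a n \<in># w"
      by (auto simp: betti_edges_def split: if_splits)
    then show False using q_factorization_eq_replicate[OF _ assms(2)] by blast
  qed
  ultimately have "(?r, ?z) \<notin> (betti_edges M (q n))\<^sup>*"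
    by (metis converse_rtranclE)
  with z show ?thesis
    unfolding Betti_iff using q_in_M[OF assms(2)] replicate_in_factorizations[OF assms(2)]
    by (intro conjI bexI)
qed

lemma betti_path_if_mdvd:
  assumes z: "z \<in> factorizations M b" "a i \<in># z" "i \<ge> 1"
    and z': "z' \<in> factorizations M b" "p j \<le> count z' (a j)" "j \<ge> 1"
    and "mdvd N (q i) (q j)" "b \<noteq> q j"
  shows "(z, z') \<in> (betti_edges M b)\<^sup>*"
proof -
  obtain K where K: "set_mset K \<subseteq> {1..}" "q j = q i + sum_mset (image_mset q K)"
    using \<open>mdvd N (q i) (q j)\<close> unfolding mdvd_def N_eq by blast
  define w where "w = z' - replicate_mset (p j) (a j)"
  have w: "z' = replicate_mset (p j) (a j) + w"
    using z'(2) by (simp add: w_def count_le_replicate_mset_subset_eq subset_mset.add_diff_inverse)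
  let ?z = "lift (add_mset i K) + w"
  have b: "b = q j + sum_mset w" and A: "set_mset w \<subseteq> A"
    using z'(1,3) w by (auto simp: factorizations_M p_mult_a)
  have sum: "sum_mset (lift (add_mset i K)) = q j"
    using sum_lift[of "add_mset i K"] K \<open>i \<ge> 1\<close> by simp
  have set: "set_mset (lift (add_mset i K)) = a ` set_mset (add_mset i K)"
    using K \<open>i \<ge> 1\<close> by (intro set_lift) auto
  have "?z \<in> factorizations M b"
    unfolding factorizations_M using A set K(1) \<open>i \<ge> 1\<close> b sum
    by (auto simp del: lift_simps simp: A_def)
  moreover have "a i \<in># ?z" using set by auto
  moreover obtain x where "x \<in># w" using b \<open>b \<noteq> q j\<close> by (cases w) auto
  ultimately have "(z, ?z) \<in> (betti_edges M b)\<^sup>*" "(?z, z') \<in> (betti_edges M b)\<^sup>*"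
    using z z' w by (auto intro: betti_path_if_common_atom simp del: lift_simps)
  then show ?thesis by (rule rtrancl_trans)
qed

lemma Betti_imp_q:
  assumes "valuation_monoid N" "b \<in> Betti M"
  shows "\<exists>n\<ge>1. b = q n"
proof (rule ccontr)
  assume neq: "\<not> ?thesis"
  obtain z z' where z: "z \<in> factorizations M b" "z' \<in> factorizations M b"
    "(z, z') \<notin> (betti_edges M b)\<^sup>*"
    using assms(2) unfolding Betti_iff by blast
  have le_count: "p n \<le> count w (a n)" if "w \<in> factorizations M b" "n \<ge> 1" "a n \<in># w" for w n
  proof -
    obtain u where u: "u \<in> factorizations M b" "a n \<notin># u"
      using z betti_path_if_common_atom by blast
    then have "int (p n) dvd int (count w (a n))"
      using count_cong[of w u n] that by (simp add: factorizations_M not_in_iff)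
    then show ?thesis using that(3) by (intro dvd_imp_le) auto
  qed
  have "z \<noteq> z'" using z(3) by auto
  then have "z \<noteq> {#}" "z' \<noteq> {#}"
    using z(1,2) sum_mset_eq_0[of z] sum_mset_eq_0[of z'] by (auto simp: factorizations_M)
  moreover have "\<exists>i\<ge>1. a i \<in># w" if "w \<in> factorizations M b" "w \<noteq> {#}" for w
  proof -
    obtain x where "x \<in># w" using \<open>w \<noteq> {#}\<close> by blast
    then have "x \<in> A" using that(1) by (auto simp: factorizations_M)
    then show ?thesis using \<open>x \<in># w\<close> by (auto simp: A_def)
  qed
  ultimately obtain i j where ij: "i \<ge> 1" "j \<ge> 1" "a i \<in># z" "a j \<in># z'"
    using z(1,2) by blast
  have "mdvd N (q i) (q j) \<or> mdvd N (q j) (q i)"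
    using assms(1) q_in_N ij by (simp add: valuation_monoid_def)
  then show False
  proof
    assume "mdvd N (q i) (q j)"
    then show False using betti_path_if_mdvd z ij le_count neq by blast
  next
    assume "mdvd N (q j) (q i)"
    then have "(z', z) \<in> (betti_edges M b)\<^sup>*"
      using betti_path_if_mdvd z ij le_count neq by blast
    then show False using z(3) sym_rtrancl[OF sym_betti_edges] by (auto dest: symD)
  qed
qed

end

theorem corollary4p3:
  fixes q :: "nat \<Rightarrow> rat" and p :: "nat \<Rightarrow> nat" and M :: "rat set"
  assumes "\<And>n. n \<ge> 1 \<Longrightarrow> q n > 0"
    and "\<And>n. n \<ge> 1 \<Longrightarrow> prime (p n)"
    and "inj_on p {1..}"
    and "\<And>i. i \<ge> 1 \<Longrightarrow> gcd (int (p i)) (rat_num (q i)) = 1"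
    and "\<And>i j. i \<ge> 1 \<Longrightarrow> j \<ge> 1 \<Longrightarrow> gcd (int (p i)) (rat_den (q j)) = 1"
    and "M = generated_monoid {q n / of_nat (p n) | n. n \<ge> 1}"
    and "antimatter (generated_monoid {q n | n. n \<ge> 1})"
    and "valuation_monoid (generated_monoid {q n | n. n \<ge> 1})"
  shows "Betti M = {q n | n. n \<ge> 1}"
proof -
  interpret atomized q p using assms(1-5) by unfold_locales
  have "{q n | n. n \<ge> 1} = q ` {1..}" by auto
  with assms(7,8) have N: "antimatter N" "valuation_monoid N" by simp_all
  have "{q n / of_nat (p n) | n. n \<ge> 1} = A" by (auto simp: A_def a_def)
  with assms(6) have "M = generated_monoid A" by simp
  then show ?thesis using q_in_Betti[OF N(1)] Betti_imp_q[OF N(2)] by auto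
qed

end
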